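(* Let $\{\mathbf{x}_1,\ldots,\mathbf{x}_N\}$ be a spherical $(n,N,\alpha)$-code, let $\mathbf{X}=(\mathbf{x}_1,\ldots,\mathbf{x}_N)\in\mathbb{R}^{n\times N}$, and let $\mathbf{M}=(x_{ij})=\mathbf{X}^{\top}\mathbf{X}$, so $x_{ij}=\langle\mathbf{x}_i,\mathbf{x}_j\rangle$. Let $c>0$ and let $f:[-1,1]\to\mathbb{R}$ be a function such that (i) $\sum_{i,j=1}^{N} f(x_{ij})\ge 0$, (ii) $f(t)+c\le 0$ for $-1\le t\le\cos\alpha$, and (iii) $f(1)+c\le 1$. Then $N\le 1/c$.
   Context: A spherical $(n,N,\alpha)$-code is a set $\{\mathbf{x}_1,\ldots,\mathbf{x}_N\}$ of $N$ unit vectors in $\mathbb{R}^n$ whose pairwise angular distances are at least $\alpha$, i.e. $\langle\mathbf{x}_i,\mathbf{x}_j\rangle\le\cos\alpha$ for $i\ne j$. *)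

theory Defs
  imports "HOL-Analysis.Analysis"
begin

text \<open>
  A spherical \<open>(n, N, \<alpha>)\<close>-code; the dimension \<open>n\<close> is \<open>CARD('n)\<close>. For unit vectors the angular
  distance of \<open>u\<close> and \<open>v\<close> is \<open>arccos (u \<bullet> v)\<close>, so for \<open>\<alpha>\<close> between \<open>0\<close> and \<open>pi\<close> the last condition
  says that distinct code points are at angular distance at least \<open>\<alpha>\<close>. The conjunct \<open>finite C\<close>
  matters only when \<open>N = 0\<close>, since infinite sets have \<open>card\<close> zero.
\<close>
definition spherical_code :: "nat \<Rightarrow> real \<Rightarrow> (real ^ 'n) set \<Rightarrow> bool" where
  "spherical_code N \<alpha> C \<longleftrightarrow>
     finite C \<and> card C = N \<and>
     (\<forall>u\<in>C. norm u = 1) \<and>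
     (\<forall>u\<in>C. \<forall>v\<in>C. u \<noteq> v \<longrightarrow> u \<bullet> v \<le> cos \<alpha>)"

end

theory Submission
  imports Defs
begin

text \<open>
  Sum \<open>f x\<^sub>i\<^sub>j + c\<close> over all pairs \<open>(i, j)\<close>. By (i) the total is at least \<open>c N\<^sup>2\<close>; by (ii) the
  off-diagonal terms are nonpositive, so by (iii) the total is at most \<open>N\<close>.
\<close>

lemma Gram_matrix_nth:
  fixes x :: "'m::finite \<Rightarrow> real ^ 'n"
  assumes "X = (\<chi> k i. x i $ k)"
  shows "(transpose X ** X) $ i $ j = x i \<bullet> x j"
  by (simp add: assms matrix_matrix_mult_def transpose_def inner_vec_def)

theorem theorem1p1:
  fixes x :: "'m::finite \<Rightarrow> real ^ 'n"
    and X :: "real ^ 'm ^ 'n"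
    and M :: "real ^ 'm ^ 'm"
    and N :: nat
    and \<alpha> c :: real
    and f :: "real \<Rightarrow> real"
  assumes N: "N = CARD('m)"
    and code: "spherical_code N \<alpha> (range x)"
    and X: "X = (\<chi> k i. x i $ k)"
    and M: "M = transpose X ** X"
    and c: "c > 0"
    and i: "(\<Sum>i\<in>UNIV. \<Sum>j\<in>UNIV. f (M $ i $ j)) \<ge> 0"
    and ii: "\<And>t. - 1 \<le> t \<Longrightarrow> t \<le> cos \<alpha> \<Longrightarrow> f t + c \<le> 0"
    and iii: "f 1 + c \<le> 1"
  shows "real N \<le> 1 / c"
proof -
  have unit: "norm (x i) = 1" for i
    using code by (auto simp: spherical_code_def)
  \<comment> \<open>\<open>spherical_code\<close> constrains distinct vectors, whereas the double
    sum runs over indices. Since \<open>range x\<close> has as many elements as the index type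
    \<open>'m\<close>, no vector repeats, so distinct indices give distinct code points.\<close>
  have inj: "inj x"
    using code N by (intro eq_card_imp_inj_on) (auto simp: spherical_code_def)
  have entry: "f (M $ i $ j) + c \<le> (if i = j then 1 else 0)" for i j
  proof (cases "i = j")
    case True
    have "x i \<bullet> x i = 1"
      using unit by (simp add: norm_eq_1)
    with True iii show ?thesis
      by (simp add: M Gram_matrix_nth [OF X])
  next
    case False
    then have "x i \<bullet> x j \<le> cos \<alpha>"
      using code inj by (auto simp: spherical_code_def inj_eq)
    \<comment> \<open>Hypothesis \<open>ii\<close> speaks only of arguments from -1 to
      \<open>cos \<alpha>\<close>; Cauchy-Schwarz for unit vectors supplies the lower end.\<close>
    moreover have "- 1 \<le> x i \<bullet> x j"
      using Cauchy_Schwarz_ineq2 [of "x i" "x j"] unit by simp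
    ultimately show ?thesis
      using False ii by (simp add: M Gram_matrix_nth [OF X])
  qed
  have "real N * real N * c
      \<le> (\<Sum>i\<in>UNIV. \<Sum>j\<in>UNIV. f (M $ i $ j)) + real N * real N * c"
    using i by simp
  also have "\<dots> = (\<Sum>i\<in>UNIV. \<Sum>j\<in>UNIV. f (M $ i $ j) + c)"
    by (simp add: sum.distrib N)
  also have "\<dots> \<le> (\<Sum>i\<in>(UNIV :: 'm set). \<Sum>j\<in>UNIV. if i = j then 1 else 0)"
    by (intro sum_mono entry)
  also have "\<dots> = real N"
    by (simp add: N)
  finally have "real N * (real N * c) \<le> real N * 1"
    by (simp add: mult.assoc)
  \<comment> \<open>Types are nonempty, so \<open>N\<close> is positive and one of the two factors
    \<open>N\<close> on the left cancels.\<close>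
  moreover have "real N > 0"
    by (simp add: N)
  ultimately have "real N * c \<le> 1"
    by (simp only: mult_le_cancel_left_pos)
  with c show ?thesis
    by (simp add: pos_le_divide_eq)
qed

end
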